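(* Let $F(x_1,\dots,x_n)$ be a quadratic form with integer coefficients. Let the matrix of the quadratic form $F$ have eigenvalues $t_1,\dots,t_n$ and corresponding eigenvectors with integer coordinates $(c_{11},\dots,c_{1n}),\dots,(c_{n1},\dots,c_{nn})$. Then the homogeneous Diophantine equation of the second order $F(x_1,\dots,x_n)=0$ is reduced to the diagonal homogeneous Diophantine equation with integer coefficients $$\Big(\sum_{i=1}^{n} c_{1i}^2\Big)t_1(x_1')^2+\dots+\Big(\sum_{i=1}^{n} c_{ni}^2\Big)t_n(x_n')^2=0$$ using the generalized orthogonal transformation $x=Cx'$ with the matrix $$C=\begin{pmatrix} c_{11} & \dots & c_{n1}\\ \vdots & & \vdots\\ c_{1n} & \dots & c_{nn}\end{pmatrix}.$$
   Context: The matrix of a quadratic form $F$ is the symmetric matrix $Q$ with $F(x)=x^{T}Qx$, where $x=(x_1,\dots,x_n)^T$; $x'=(x_1',\dots,x_n')^T$ denotes the new coordinates. A generalized orthogonal transformation is an affine transformation that preserves the perpendicularity of the basis vectors but not necessarily their lengths: it consists of an orthogonal transformation followed by a stretching of the basis vectors, $x_i'\mapsto k_i x_i'$, with real coefficients $k_1,\dots,k_n$ that may differ from one another.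
   Formalization: Eigenvectors belonging to equal eigenvalues are additionally assumed orthogonal; otherwise the claim fails, e.g. for x_1^2+x_2^2 with eigenvectors (1,0) and (1,1), where C is not generalized orthogonal and a mixed term remains. *)

theory Defs
  imports "HOL-Analysis.Analysis"
begin

(* The integer matrix a need not be symmetric: the coefficient of x_i * x_j for i \<noteq> j is
   a i j + a j i, so exactly the homogeneous quadratic polynomials with integer coefficients
   arise, including those with odd mixed coefficients (whose symmetric matrix has
   half-integer entries). *)
definition integer_quadratic_form :: "(real^'n \<Rightarrow> real) \<Rightarrow> bool" where
  "integer_quadratic_form F \<longleftrightarrow>
     (\<exists>a :: 'n \<Rightarrow> 'n \<Rightarrow> int. \<forall>x. F x = (\<Sum>i\<in>UNIV. \<Sum>j\<in>UNIV. of_int (a i j) * x $ i * x $ j))"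

definition matrix_of_form :: "(real^'n \<Rightarrow> real) \<Rightarrow> real^'n^'n \<Rightarrow> bool" where
  "matrix_of_form F Q \<longleftrightarrow> transpose Q = Q \<and> (\<forall>x. F x = x \<bullet> (Q *v x))"

definition eigenpair :: "real^'n^'n \<Rightarrow> real \<Rightarrow> real^'n \<Rightarrow> bool" where
  "eigenpair Q t v \<longleftrightarrow> v \<noteq> 0 \<and> Q *v v = t *s v"

definition real_vec :: "int^'n \<Rightarrow> real^'n" where
  "real_vec v = (\<chi> k. of_int (v $ k))"

(* The vectors c i are the columns. *)
definition column_matrix :: "('n \<Rightarrow> int^'n) \<Rightarrow> real^'n^'n" where
  "column_matrix c = (\<chi> k i. of_int (c i $ k))"

definition diagonal_form :: "('n::finite \<Rightarrow> real) \<Rightarrow> real^'n \<Rightarrow> real" where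
  "diagonal_form d x = (\<Sum>i\<in>UNIV. d i * (x $ i)\<^sup>2)"

(* The columns of C are the images of the standard basis: P sends it to an orthonormal basis,
   whose i-th vector is then stretched by k i, which amounts to multiplying P by the diagonal
   matrix of the k i on the right. The k i are nonzero because C has to be a change of
   coordinates. *)
definition generalized_orthogonal :: "real^'n^'n \<Rightarrow> bool" where
  "generalized_orthogonal C \<longleftrightarrow>
     (\<exists>P k. orthogonal_matrix P \<and> (\<forall>i. k i \<noteq> 0) \<and>
            C = P ** (\<chi> i j. if i = j then k i else 0))"

definition integer_points :: "(real^'n) set" where
  "integer_points = {x. \<forall>i. x $ i \<in> \<int>}"

definition rational_points :: "(real^'n) set" where
  "rational_points = {x. \<forall>i. x $ i \<in> \<rat>}"

(* The equation F x = 0 is reduced to G y = 0 by the substitution x = C y: the substitution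
   turns F into G, integer points give integer points, and it matches the rational solutions
   of the two equations one to one. For homogeneous equations rational solutions are integer
   solutions up to a common factor; a bijection between the integer solutions themselves
   cannot be asked for, since C need not be unimodular. *)
definition reduces_via ::
    "real^'n^'n \<Rightarrow> (real^'n \<Rightarrow> real) \<Rightarrow> (real^'n \<Rightarrow> real) \<Rightarrow> bool" where
  "reduces_via C F G \<longleftrightarrow>
     (\<forall>y. F (C *v y) = G y) \<and>
     (\<forall>y\<in>integer_points. C *v y \<in> integer_points) \<and>
     bij_betw (\<lambda>y. C *v y) {y \<in> rational_points. G y = 0} {x \<in> rational_points. F x = 0}"

end

theory Submission
  imports Defs
begin

text \<open>
  Let \<open>C\<close> be the matrix with columns \<open>c\<^sub>i\<close>, and let \<open>s\<^sub>i\<close> be the squared length of \<open>c\<^sub>i\<close>.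
  The matrix \<open>Q\<close> is symmetric, so eigenvectors for different eigenvalues are orthogonal
  (\<open>symmetric_eigenvectors_orthogonal\<close>); for equal eigenvalues orthogonality is a
  hypothesis. Hence \<open>C\<^sup>T C = diag s\<close>. Everything follows from this identity together with \<open>Q C = C diag t\<close>:

  \<^item> Dividing the columns by their lengths gives an orthogonal matrix, so \<open>C\<close> is an orthogonal
    transformation composed with a stretching (\<open>generalized_orthogonal_if_orthogonal_columns\<close>).

  \<^item> \<open>C\<^sup>T Q C = C\<^sup>T C diag t = diag (s t)\<close>, so the substitution \<open>x = C y\<close> makes the form
    diagonal (\<open>form_diagonal_in_eigenbasis\<close>).

  \<^item> The coefficient \<open>s\<^sub>i t\<^sub>i\<close> equals \<open>c\<^sub>i \<bullet> Q c\<^sub>i = F(c\<^sub>i)\<close>, the value of an integer form at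
    an integer point, hence an integer. The \<open>t\<^sub>i\<close> themselves need not be integers: the form
    \<open>x\<^sub>1 x\<^sub>2\<close> has the eigenvalues \<open>1/2\<close> and \<open>-1/2\<close>.

  \<^item> \<open>C\<close> has the inverse \<open>diag (1/s) C\<^sup>T\<close>, whose entries are rational like those of \<open>C\<close>, so
    \<open>C\<close> matches the rational zeros of the two forms one to one.
\<close>

abbreviation diag :: "('n \<Rightarrow> real) \<Rightarrow> real^'n^'n" where
  "diag d \<equiv> (\<chi> i j. if i = j then d i else 0)"

section \<open>Matrices with orthogonal columns\<close>

lemma diag_mult_vector: "diag d *v y = (\<chi> i. d i * y $ i)"
  by (simp add: vec_eq_iff matrix_vector_mult_def
      if_distrib[where f = "\<lambda>x. x * a" for a] cong: if_cong)

lemma diag_mult_diag: "diag d ** diag e = diag (\<lambda>i. d i * e i)"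
  by (simp add: vec_eq_iff matrix_matrix_mult_def
      if_distrib[where f = "\<lambda>x. x * a" for a] cong: if_cong)

lemma transpose_diag: "transpose (diag d) = diag d"
  by (auto simp: vec_eq_iff transpose_def)

lemma diag_mult_diag_eq_one:
  assumes "\<And>i. d i * e i = 1"
  shows "diag d ** diag e = mat 1"
  unfolding diag_mult_diag assms by (simp add: mat_def)

lemma inner_diag_mult_vector: "y \<bullet> (diag d *v y) = diagonal_form d y"
  by (simp add: diag_mult_vector diagonal_form_def inner_vec_def power2_eq_square mult_ac)

lemma gram_matrix_diag:
  fixes C :: "real^'n^'n"
  assumes "\<And>i j. i \<noteq> j \<Longrightarrow> orthogonal (column i C) (column j C)"
  shows "transpose C ** C = diag (\<lambda>i. column i C \<bullet> column i C)"
  using assms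
  by (simp add: vec_eq_iff matrix_mult_transpose_dot_column orthogonal_def)

lemma generalized_orthogonal_if_orthogonal_columns:
  fixes C :: "real^'n^'n"
  assumes gram: "transpose C ** C = diag s" and pos: "\<And>i. s i > 0"
  shows "generalized_orthogonal C"
proof -
  let ?D = "diag (\<lambda>i. 1 / sqrt (s i))"
  have nz: "sqrt (s i) \<noteq> 0" for i
    using pos[of i] by simp
  have "transpose (C ** ?D) ** (C ** ?D) = ?D ** (transpose C ** C) ** ?D"
    by (simp only: matrix_transpose_mul transpose_diag matrix_mul_assoc)
  also have "\<dots> = mat 1"
    unfolding gram diag_mult_diag[of _ s]
  proof (rule diag_mult_diag_eq_one)
    show "1 / sqrt (s i) * s i * (1 / sqrt (s i)) = 1" for i
      using pos[of i] by simp
  qed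
  finally have "orthogonal_matrix (C ** ?D)"
    by (simp only: orthogonal_matrix)
  moreover have "C = (C ** ?D) ** diag (\<lambda>i. sqrt (s i))"
  proof -
    have "?D ** diag (\<lambda>i. sqrt (s i)) = mat 1"
      using nz by (intro diag_mult_diag_eq_one) simp
    then show ?thesis
      by (simp only: matrix_mul_assoc[symmetric] matrix_mul_rid)
  qed
  ultimately show ?thesis
    unfolding generalized_orthogonal_def using nz
    by (intro exI[of _ "C ** ?D"] exI[of _ "\<lambda>i. sqrt (s i)"] conjI allI)
qed

text \<open>
  A one-sided computation suffices for the second identity, because a left inverse of a
  square matrix is also a right inverse.
\<close>
lemma orthogonal_columns_inverse:
  fixes C :: "real^'n^'n"
  assumes gram: "transpose C ** C = diag s" and nz: "\<And>i. s i \<noteq> 0"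
  defines "B \<equiv> diag (\<lambda>i. 1 / s i) ** transpose C"
  shows "B ** C = mat 1" and "C ** B = mat 1"
proof -
  have "B ** C = diag (\<lambda>i. 1 / s i) ** (transpose C ** C)"
    unfolding B_def by (simp only: matrix_mul_assoc)
  also have "\<dots> = mat 1"
    unfolding gram using nz by (intro diag_mult_diag_eq_one) simp
  finally show "B ** C = mat 1" .
  then show "C ** B = mat 1"
    by (simp add: matrix_left_right_inverse)
qed

section \<open>Eigenvectors of a symmetric matrix\<close>

text \<open>Moving \<open>Q\<close> across the inner product gives \<open>t (v \<bullet> w) = u (v \<bullet> w)\<close>.\<close>
lemma symmetric_eigenvectors_orthogonal:
  fixes Q :: "real^'n^'n"
  assumes "transpose Q = Q" "eigenpair Q t v" "eigenpair Q u w" "t \<noteq> u"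
  shows "orthogonal v w"
proof -
  have "(Q *v v) \<bullet> w = v \<bullet> (Q *v w)"
    using assms(1) by (metis dot_lmul_matrix vector_transpose_matrix)
  then have "t * (v \<bullet> w) = u * (v \<bullet> w)"
    using assms(2,3) by (simp add: eigenpair_def scalar_mult_eq_scaleR)
  then show ?thesis
    using assms(4) by (simp add: orthogonal_def)
qed

lemma form_diagonal_in_eigenbasis:
  fixes Q C :: "real^'n^'n"
  assumes gram: "transpose C ** C = diag s"
    and eig: "\<And>i. eigenpair Q (t i) (column i C)"
  shows "(C *v y) \<bullet> (Q *v (C *v y)) = diagonal_form (\<lambda>i. s i * t i) y"
proof -
  have QC: "Q ** C = C ** diag t"
  proof -
    have "(Q ** C) $ k $ i = (C ** diag t) $ k $ i" for k i
    proof -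
      have "(Q ** C) $ k $ i = (Q *v column i C) $ k"
        by (simp add: matrix_matrix_mult_def matrix_vector_mult_def column_def)
      also have "\<dots> = C $ k $ i * t i"
        using eig[of i] by (simp add: eigenpair_def column_def)
      also have "\<dots> = (C ** diag t) $ k $ i"
        by (simp add: matrix_matrix_mult_def
              if_distrib[where f = "\<lambda>x. a * x" for a] cong: if_cong)
      finally show ?thesis .
    qed
    then show ?thesis
      by (simp add: vec_eq_iff)
  qed
  have "(C *v y) \<bullet> (Q *v (C *v y)) = y \<bullet> (transpose C *v (Q *v (C *v y)))"
    by (metis dot_lmul_matrix vector_transpose_matrix)
  also have "transpose C *v (Q *v (C *v y)) = (transpose C ** (Q ** C)) *v y"
    by (simp only: matrix_vector_mul_assoc matrix_mul_assoc)
  also have "transpose C ** (Q ** C) = (transpose C ** C) ** diag t"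
    by (simp only: QC matrix_mul_assoc)
  also have "\<dots> = diag (\<lambda>i. s i * t i)"
    by (simp only: gram diag_mult_diag)
  finally show ?thesis
    by (simp only: inner_diag_mult_vector)
qed

section \<open>Integrality and rationality\<close>

lemma integer_quadratic_form_Ints:
  assumes "integer_quadratic_form F" "x \<in> integer_points"
  shows "F x \<in> \<int>"
  using assms unfolding integer_quadratic_form_def integer_points_def
  by (auto intro!: Ints_sum Ints_mult)

lemma matrix_vector_mult_integer_points:
  assumes "\<And>i j. A $ i $ j \<in> \<int>" "y \<in> integer_points"
  shows "A *v y \<in> integer_points"
  using assms unfolding integer_points_def matrix_vector_mult_def
  by (auto intro!: Ints_mult)

lemma matrix_vector_mult_rational_points:
  assumes "\<And>i j. A $ i $ j \<in> \<rat>" "y \<in> rational_points"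
  shows "A *v y \<in> rational_points"
  using assms unfolding rational_points_def matrix_vector_mult_def
  by auto

lemma rational_zeros_bij_betw:
  fixes C B :: "real^'n^'n"
  assumes inv: "B ** C = mat 1" "C ** B = mat 1"
    and rat: "\<And>i j. C $ i $ j \<in> \<rat>" "\<And>i j. B $ i $ j \<in> \<rat>"
    and subst: "\<And>y. F (C *v y) = G y"
  shows "bij_betw (\<lambda>y. C *v y) {y \<in> rational_points. G y = 0} {x \<in> rational_points. F x = 0}"
proof (rule bij_betw_byWitness[where f' = "\<lambda>x. B *v x"])
  have BC: "B *v (C *v y) = y" and CB: "C *v (B *v y) = y" for y
    by (simp_all add: matrix_vector_mul_assoc inv)
  have G: "G (B *v x) = F x" for x
    using subst[of "B *v x"] by (simp add: CB)
  show "\<forall>y\<in>{y \<in> rational_points. G y = 0}. B *v (C *v y) = y"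
    by (simp add: BC)
  show "\<forall>x\<in>{x \<in> rational_points. F x = 0}. C *v (B *v x) = x"
    by (simp add: CB)
  show "(\<lambda>y. C *v y) ` {y \<in> rational_points. G y = 0} \<subseteq> {x \<in> rational_points. F x = 0}"
    using rat(1) by (auto simp: subst intro: matrix_vector_mult_rational_points)
  show "(\<lambda>x. B *v x) ` {x \<in> rational_points. F x = 0} \<subseteq> {y \<in> rational_points. G y = 0}"
    using rat(2) by (auto simp: G intro: matrix_vector_mult_rational_points)
qed

section \<open>Reduction to diagonal form\<close>

lemma column_column_matrix: "column i (column_matrix c) = real_vec (c i)"
  by (simp add: column_def column_matrix_def real_vec_def)

theorem mainTheorem3:
  fixes F :: "real^'n \<Rightarrow> real"
    and Q :: "real^'n^'n"
    and t :: "'n \<Rightarrow> real"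
    and c :: "'n \<Rightarrow> int^'n"
  assumes "integer_quadratic_form F"
    and "matrix_of_form F Q"
    and "\<And>i. eigenpair Q (t i) (real_vec (c i))"
    and "\<And>i j. i \<noteq> j \<Longrightarrow> t i = t j \<Longrightarrow> orthogonal (real_vec (c i)) (real_vec (c j))"
  shows "generalized_orthogonal (column_matrix c)
    \<and> (\<forall>i. (\<Sum>k\<in>UNIV. (of_int (c i $ k))\<^sup>2) * t i \<in> \<int>)
    \<and> reduces_via (column_matrix c) F
         (diagonal_form (\<lambda>i. (\<Sum>k\<in>UNIV. (of_int (c i $ k))\<^sup>2) * t i))"
proof -
  define C where "C = column_matrix c"
  define s :: "'n \<Rightarrow> real" where "s = (\<lambda>i. \<Sum>k\<in>UNIV. (of_int (c i $ k))\<^sup>2)"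
  have sym: "transpose Q = Q" and F: "F x = x \<bullet> (Q *v x)" for x
    using assms(2) by (auto simp: matrix_of_form_def)
  have s_inner: "s i = real_vec (c i) \<bullet> real_vec (c i)" for i
    by (simp add: s_def real_vec_def inner_vec_def power2_eq_square)
  have s_pos: "s i > 0" for i
    using assms(3)[of i] by (simp add: s_inner eigenpair_def)
  have orth: "orthogonal (real_vec (c i)) (real_vec (c j))" if "i \<noteq> j" for i j
    using that assms(4) symmetric_eigenvectors_orthogonal[OF sym assms(3) assms(3)] by blast
  have gram: "transpose C ** C = diag s"
  proof -
    have "transpose C ** C = diag (\<lambda>i. column i C \<bullet> column i C)"
      by (rule gram_matrix_diag) (simp add: C_def column_column_matrix orth)
    also have "(\<lambda>i. column i C \<bullet> column i C) = s"
      by (simp add: C_def column_column_matrix s_inner fun_eq_iff)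
    finally show ?thesis .
  qed

  have coeff: "s i * t i \<in> \<int>" for i
  proof -
    have "s i * t i = F (real_vec (c i))"
      using assms(3)[of i] by (simp add: F s_inner eigenpair_def scalar_mult_eq_scaleR)
    moreover have "real_vec (c i) \<in> integer_points"
      by (simp add: integer_points_def real_vec_def)
    ultimately show ?thesis
      using integer_quadratic_form_Ints[OF assms(1)] by simp
  qed

  have subst: "F (C *v y) = diagonal_form (\<lambda>i. s i * t i) y" for y
    unfolding F using form_diagonal_in_eigenbasis[OF gram] assms(3)
    by (simp add: C_def column_column_matrix)
  have C_int: "C $ i $ j \<in> \<int>" for i j
    by (simp add: C_def column_matrix_def)
  have s_rat: "s i \<in> \<rat>" for i
    unfolding s_def by auto
  let ?B = "diag (\<lambda>i. 1 / s i) ** transpose C"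
  have B_rat: "?B $ i $ j \<in> \<rat>" for i j
  proof -
    have "?B $ i $ j = 1 / s i * C $ j $ i"
      by (simp add: matrix_matrix_mult_def transpose_def
          if_distrib[where f = "\<lambda>x. x * a" for a] cong: if_cong)
    then show ?thesis
      using s_rat[of i] by (simp add: C_def column_matrix_def)
  qed
  have s_nz: "s i \<noteq> 0" for i
    using s_pos[of i] by simp
  have "reduces_via C F (diagonal_form (\<lambda>i. s i * t i))"
    unfolding reduces_via_def
  proof (intro conjI allI ballI)
    show "F (C *v y) = diagonal_form (\<lambda>i. s i * t i) y" for y
      by (rule subst)
    show "C *v y \<in> integer_points" if "y \<in> integer_points" for y
      using C_int that by (rule matrix_vector_mult_integer_points)
    show "bij_betw (\<lambda>y. C *v y)
        {y \<in> rational_points. diagonal_form (\<lambda>i. s i * t i) y = 0}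
        {x \<in> rational_points. F x = 0}"
    proof (rule rational_zeros_bij_betw)
      show "?B ** C = mat 1" "C ** ?B = mat 1"
        using orthogonal_columns_inverse[OF gram s_nz] by simp_all
      show "C $ i $ j \<in> \<rat>" for i j
        using C_int Ints_subset_Rats by blast
    qed (fact B_rat subst)+
  qed
  moreover have "generalized_orthogonal C"
    using gram s_pos by (rule generalized_orthogonal_if_orthogonal_columns)
  ultimately show ?thesis
    using coeff by (simp add: C_def s_def)
qed

end
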